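(* Let $a,m$ be positive integers such that $N=5^{2a}m^2$ is a friend of $10$. Then $\Omega(N)\ge 2\,\omega(N)+6a-4$.
   Context: For a positive integer $n$, $\sigma(n)$ denotes the sum of the positive divisors of $n$ and $I(n)=\sigma(n)/n$. A positive integer $N>10$ is called a friend of $10$ if $I(N)=9/5$. $\Omega(n)$ denotes the total number of prime factors of $n$ counted with multiplicity, and $\omega(n)$ the number of distinct prime factors of $n$. *)

theory Defs
  imports Complex_Main "HOL-Computational_Algebra.Primes"
begin

definition sigma :: "nat \<Rightarrow> nat" where
  "sigma n = (\<Sum>d | d dvd n. d)"

definition abundancy :: "nat \<Rightarrow> rat" where
  "abundancy n = of_nat (sigma n) / of_nat n"

definition friend_of_10 :: "nat \<Rightarrow> bool" where
  "friend_of_10 N \<longleftrightarrow> N > 10 \<and> abundancy N = 9 / 5"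

definition big_omega :: "nat \<Rightarrow> nat" where
  "big_omega n = size (prime_factorization n)"

definition small_omega :: "nat \<Rightarrow> nat" where
  "small_omega n = card (prime_factors n)"

end

theory Submission
  imports Defs "HOL-Number_Theory.Cong"
begin

text \<open>
  Write \<open>b \<ge> 2a\<close> for the exponent of 5 in \<open>N\<close>. Since \<open>5 \<sigma>(N) = 9 N\<close>, the factors \<open>\<sigma>(q\<^sup>f)\<close> with
  \<open>q\<^sup>f\<close> exactly dividing \<open>N\<close> together contain exactly \<open>b - 1\<close> factors 5, and none of them comes
  from \<open>q = 5\<close>. All \<open>f\<close> are even, and for odd \<open>f + 1\<close> the number \<open>1 + q + \<dots> + q\<^sup>f\<close> can only be
  divisible by \<open>5\<^sup>k\<close> with \<open>k > 0\<close> if \<open>q\<close> is 1 mod 5 and \<open>5\<^sup>k\<close> divides \<open>f + 1\<close>; hence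
  \<open>f - 2 \<ge> 5\<^sup>k - 3 \<ge> 2k\<close>. Summing \<open>f - 2\<close> over all primes gives
  \<open>\<Omega>(N) - 2\<omega>(N) \<ge> (b - 2) + 2(b - 1) \<ge> 6a - 4\<close>.
\<close>

section \<open>Multiplicativity of the divisor sum\<close>

lemma bij_betw_mult_divisors:
  fixes a b :: nat
  assumes "coprime a b"
  shows "bij_betw (\<lambda>(x, y). x * y) ({d. d dvd a} \<times> {d. d dvd b}) {d. d dvd a * b}"
  unfolding bij_betw_def
proof
  \<comment> \<open>Taking the gcd with \<open>a\<close> and with \<open>b\<close> recovers both
    factors from their product, whence injectivity.\<close>
  have left: "gcd (x * y) a = x" if "x dvd a" "y dvd b" for x y
  proof -
    have "coprime y a"
      using that(2) assms(1) by (meson coprime_commute coprime_divisors dvd_refl)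
    then show ?thesis
      using that(1) by (simp add: gcd_mult_left_right_cancel coprime_commute gcd_nat.absorb1)
  qed
  have right: "gcd (x * y) b = y" if "x dvd a" "y dvd b" for x y
  proof -
    have "coprime x b"
      using that(1) assms(1) by (meson coprime_divisors dvd_refl)
    then show ?thesis
      using that(2) by (simp add: gcd_mult_left_left_cancel coprime_commute gcd_nat.absorb1)
  qed
  show "inj_on (\<lambda>(x, y). x * y) ({d. d dvd a} \<times> {d. d dvd b})"
  proof (rule inj_onI, clarsimp)
    fix x y x' y'
    assume "x dvd a" "y dvd b" "x' dvd a" "y' dvd b" "x * y = x' * y'"
    then show "x = x' \<and> y = y'"
      using left right by metis
  qed
  show "(\<lambda>(x, y). x * y) ` ({d. d dvd a} \<times> {d. d dvd b}) = {d. d dvd a * b}"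
    by (auto simp: mult_dvd_mono image_iff dest: division_decomp)
qed

lemma sigma_mult_coprime:
  assumes "coprime a b"
  shows "sigma (a * b) = sigma a * sigma b"
proof -
  have "sigma (a * b) = (\<Sum>(x, y)\<in>{d. d dvd a} \<times> {d. d dvd b}. x * y)"
    unfolding sigma_def
    using sum.reindex_bij_betw[OF bij_betw_mult_divisors[OF assms], of "\<lambda>d. d"]
    by (simp add: case_prod_unfold)
  also have "\<dots> = sigma a * sigma b"
    by (simp add: sigma_def sum_product sum.cartesian_product)
  finally show ?thesis .
qed

lemma sigma_prime_power:
  assumes "prime p"
  shows "sigma (p ^ k) = (\<Sum>i<Suc k. p ^ i)"
proof -
  have "{d. d dvd p ^ k} = (\<lambda>i. p ^ i) ` {..<Suc k}"
    using divides_primepow_nat[OF assms] by (auto simp: less_Suc_eq_le)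
  moreover have "inj_on (\<lambda>i. p ^ i) {..<Suc k}"
    using prime_gt_1_nat[OF assms] by (auto intro!: inj_onI)
  ultimately show ?thesis
    unfolding sigma_def by (simp only: sum.reindex comp_def)
qed

lemma sigma_prod_prime_powers:
  assumes "finite P" "\<And>p. p \<in> P \<Longrightarrow> prime p"
  shows "sigma (\<Prod>p\<in>P. p ^ f p) = (\<Prod>p\<in>P. \<Sum>i<Suc (f p). p ^ i)"
  using assms
proof (induction P rule: finite_induct)
  case empty
  show ?case by (simp add: sigma_def)
next
  case (insert q P)
  have "coprime (q ^ f q) (\<Prod>p\<in>P. p ^ f p)"
    using insert.hyps insert.prems
    by (intro prod_coprime_right) (metis coprime_power_left_iff coprime_power_right_iff insertCI primes_coprime)
  then show ?case
    using insert by (simp add: sigma_mult_coprime sigma_prime_power del: sum.lessThan_Suc)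
qed

section \<open>Powers of 5 dividing geometric sums\<close>

lemma geometric_sum_add:
  fixes q :: nat
  shows "(\<Sum>i<n + k. q ^ i) = (\<Sum>i<n. q ^ i) + q ^ n * (\<Sum>i<k. q ^ i)"
  by (induction k) (auto simp: algebra_simps power_add)

text \<open>Groups the exponents into \<open>m\<close> blocks of length \<open>k\<close>. With
  \<open>m = 5\<close> this strips one factor 5 off the number of terms.\<close>

lemma geometric_sum_mult:
  fixes q :: nat
  shows "(\<Sum>i<k * m. q ^ i) = (\<Sum>i<k. q ^ i) * (\<Sum>j<m. (q ^ k) ^ j)"
proof (induction m)
  case (Suc m)
  have "(\<Sum>i<k * Suc m. q ^ i) = (\<Sum>i<k * m. q ^ i) + (q ^ k) ^ m * (\<Sum>i<k. q ^ i)"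
    by (simp only: mult_Suc_right add.commute[of k] geometric_sum_add power_mult)
  then show ?case
    using Suc by (simp add: algebra_simps)
qed simp

text \<open>The units mod 5 form a group of order 4, so an odd power is 1 only for the residue 1.
  The proof checks residues: squares of 2 and 3 are -1, so their odd powers stay in
  \<open>{2, 3}\<close>, and those of 4 stay 4.\<close>

lemma odd_power_mod_5_eq_1:
  fixes q :: nat
  assumes "odd n" "q ^ n mod 5 = 1"
  shows "q mod 5 = 1"
proof -
  obtain k where n: "n = 2 * k + 1"
    using assms(1) by (auto elim: oddE)
  have r: "(q mod 5) ^ n mod 5 = 1"
    using assms(2) by (simp add: power_mod)
  have step: "r ^ (2 * Suc k + 1) mod 5 = (r ^ (2 * k + 1) mod 5) * (r * r) mod 5" for r k :: nat
  proof -
    have "r ^ (2 * Suc k + 1) = r ^ (2 * k + 1) * (r * r)" by simp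
    then show ?thesis by (simp only: mod_mult_left_eq)
  qed
  have "2 ^ (2 * k + 1) mod 5 \<in> {2, 3 :: nat}"
    by (induction k) (use step[of 2] in auto)
  moreover have "3 ^ (2 * k + 1) mod 5 \<in> {2, 3 :: nat}"
    by (induction k) (use step[of 3] in auto)
  moreover have "4 ^ (2 * k + 1) mod 5 = (4 :: nat)"
    by (induction k) (use step[of 4] in auto)
  moreover have "q mod 5 \<in> {0, 1, 2, 3, 4}"
    unfolding insert_iff empty_iff by presburger
  ultimately show ?thesis
    using r unfolding n by (elim insertE emptyE) simp_all
qed

text \<open>Telescoping, written without subtraction, gives \<open>q ^ n\<close> = 1 mod 5, so
  \<open>q\<close> is 1 mod 5 as \<open>n\<close> is odd. Then every summand is 1 mod 5 and the sum
  is congruent to \<open>n\<close>.\<close>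

lemma five_dvd_geometric_sum:
  fixes q :: nat
  assumes "odd n" "5 dvd (\<Sum>i<n. q ^ i)"
  shows "q mod 5 = 1" "5 dvd n"
proof -
  let ?S = "\<Sum>i<n. q ^ i"
  have eq: "q ^ n + ?S = q * ?S + 1"
  proof (induction n)
    case (Suc n)
    then show ?case by (simp add: distrib_left)
  qed simp
  have "x mod 5 = 1" if "x + s = y + 1" "s mod 5 = 0" "y mod 5 = 0" for x s y :: nat
    using that by presburger
  from this[OF eq] have "q ^ n mod 5 = 1"
    using assms(2) by auto
  then show q: "q mod 5 = 1"
    by (rule odd_power_mod_5_eq_1[OF assms(1)])
  have "[?S = (\<Sum>i<n. 1 ^ i)] (mod 5)"
    by (intro cong_sum cong_pow) (use q in \<open>simp add: cong_def\<close>)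
  then show "5 dvd n"
    using assms(2) by (simp add: cong_dvd_iff)
qed

lemma not_25_dvd_geometric_sum_5:
  fixes r :: nat
  assumes "r mod 5 = 1"
  shows "\<not> 25 dvd (\<Sum>i<5. r ^ i)"
proof -
  obtain t where t: "r = 5 * t + 1"
    using assms by (metis mult_div_mod_eq)
  have "(\<Sum>i<5. r ^ i) = 1 + r * (1 + r * (1 + r * (1 + r)))"
    by (simp add: lessThan_nat_numeral lessThan_Suc algebra_simps eval_nat_numeral)
  \<comment> \<open>The expansion of ((1 + x)^5 - 1) / x = 5 + 10x + 10x^2 + 5x^3 + x^4 at x =
    5t.\<close>
  also have "\<dots> = 25 * (2 * t + 10 * (t * t) + 25 * (t * t * t) + 25 * (t * t * t * t)) + 5"
    unfolding t by (simp add: algebra_simps)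
  finally have "(\<Sum>i<5. r ^ i) mod 25 = 5"
    by (simp only: mod_mult_self4 mod_less)
  then show ?thesis by auto
qed

text \<open>Induction on \<open>k\<close>: for \<open>n = n' * 5\<close> the sum is the one of
  length \<open>n'\<close> times a five-term sum with ratio \<open>q ^ n'\<close>, which is 1 mod 5.
  The second factor takes up at most one 5, so \<open>5 ^ k\<close> divides the first.\<close>

lemma five_power_dvd_geometric_sum:
  fixes q :: nat
  assumes "odd n" "5 ^ k dvd (\<Sum>i<n. q ^ i)"
  shows "5 ^ k dvd n"
  using assms
proof (induction k arbitrary: n)
  case (Suc k)
  have "5 dvd (\<Sum>i<n. q ^ i)"
    using Suc.prems(2) by (rule dvd_trans[rotated]) simp
  note q = five_dvd_geometric_sum[OF Suc.prems(1) this]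
  obtain n' where n': "n = n' * 5"
    using q(2) by (auto elim: dvdE)
  let ?S = "\<Sum>i<n'. q ^ i" and ?T = "\<Sum>j<5. (q ^ n') ^ j"
  have eq: "(\<Sum>i<n. q ^ i) = ?S * ?T"
    unfolding n' by (rule geometric_sum_mult)
  have "q ^ n' mod 5 = 1"
    using q(1) by (subst power_mod[symmetric]) simp
  then have T: "\<not> 25 dvd ?T"
    by (rule not_25_dvd_geometric_sum_5)
  have "5 ^ k dvd ?S"
  proof (cases "5 dvd ?T")
    case True
    then obtain u where u: "?T = 5 * u" by (auto elim: dvdE)
    have "\<not> 5 dvd u"
      using T unfolding u by presburger
    then have "coprime (5 ^ k) u"
      by (intro coprime_power_left_iff[THEN iffD2] disjI1 prime_imp_coprime) auto
    moreover have "5 ^ k dvd ?S * u"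
      using Suc.prems(2) unfolding eq u by simp
    ultimately show ?thesis
      by (simp add: coprime_dvd_mult_left_iff)
  next
    case False
    then have "coprime (5 ^ Suc k) ?T"
      by (intro coprime_power_left_iff[THEN iffD2] disjI1 prime_imp_coprime) auto
    then have "5 ^ Suc k dvd ?S"
      using Suc.prems(2) unfolding eq by (simp only: coprime_dvd_mult_left_iff)
    then show ?thesis by (rule dvd_trans[rotated]) simp
  qed
  then have "5 ^ k dvd n'"
    using Suc.IH Suc.prems(1) n' by auto
  then show ?case unfolding n' by simp
qed simp

lemma multiplicity_5_geometric_sum_le:
  fixes q :: nat
  assumes "odd n" "n \<ge> 3"
  shows "2 * multiplicity 5 (\<Sum>i<n. q ^ i) + 3 \<le> n"
proof (cases "multiplicity 5 (\<Sum>i<n. q ^ i)")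
  case 0
  then show ?thesis using assms(2) by simp
next
  case (Suc k)
  have "5 ^ Suc k dvd n"
    using five_power_dvd_geometric_sum[OF assms(1)] multiplicity_dvd Suc by metis
  then have "5 ^ Suc k \<le> n"
    using assms(2) by (intro dvd_imp_le) auto
  \<comment> \<open>Equality holds at \<open>k = 0\<close>, where both sides are 5.\<close>
  moreover have "2 * Suc k + 3 \<le> 5 ^ Suc k"
    by (induction k) auto
  ultimately show ?thesis
    unfolding Suc by (rule order_trans[rotated])
qed

theorem theorem1p10:
  fixes a m N :: nat
  assumes "a > 0" and "m > 0"
    and "N = 5 ^ (2 * a) * m ^ 2"
    and "friend_of_10 N"
  shows "int (big_omega N) \<ge> 2 * int (small_omega N) + 6 * int a - 4"
proof -
  define P where "P = prime_factors N"
  define f where "f p = multiplicity p N" for p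
  define S where "S p = (\<Sum>i<Suc (f p). p ^ i)" for p
  have N0: "N > 0" using assms(2,3) by simp
  have fin: "finite P" by (simp add: P_def)
  have prime: "prime p" if "p \<in> P" for p
    using that by (auto simp: P_def)
  have N_sq: "N = (5 ^ a * m) ^ 2"
    using assms(3) by (simp add: power_mult_distrib power_mult mult.commute)
  have f_even: "even (f p)" if "p \<in> P" for p
    using prime[OF that] assms(2) unfolding f_def N_sq
    by (subst prime_elem_multiplicity_power_distrib) auto
  have f_ge: "f p \<ge> 2" if "p \<in> P" for p
  proof -
    have "f p > 0" using that by (simp add: P_def f_def prime_factors_multiplicity)
    then show ?thesis using f_even[OF that] by presburger
  qed
  \<comment> \<open>Only an inequality, since 5 may also divide \<open>m\<close>.\<close>
  have b: "f 5 \<ge> 2 * a"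
    unfolding f_def using N0 assms(3) by (intro multiplicity_geI) auto
  have P5: "5 \<in> P"
    using b assms(1) by (auto simp: P_def f_def prime_factors_multiplicity)
  have S0: "S p > 0" for p
    by (simp add: S_def sum.lessThan_Suc_shift del: sum.lessThan_Suc)
  have "N = (\<Prod>p\<in>P. p ^ f p)"
    unfolding P_def f_def using N0 by (intro prime_factorization_nat)
  then have sig: "sigma N = (\<Prod>p\<in>P. S p)"
    unfolding S_def using sigma_prod_prime_powers[OF fin prime, of f] by metis
  have "of_nat (sigma N) / of_nat N = (9 / 5 :: rat)"
    using assms(4) by (simp add: friend_of_10_def abundancy_def)
  then have "of_nat (5 * sigma N) = (of_nat (9 * N) :: rat)"
    using N0 by (simp add: field_simps)
  then have eq: "5 * sigma N = 9 * N"
    by (simp only: of_nat_eq_iff)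
  have "sigma N > 0" using eq N0 by simp
  have "1 + multiplicity 5 (sigma N) = multiplicity 5 (5 * sigma N)"
    using \<open>sigma N > 0\<close> by (subst prime_elem_multiplicity_mult_distrib) auto
  also have "\<dots> = f 5"
    unfolding eq f_def using N0
    by (subst prime_elem_multiplicity_mult_distrib) (auto simp: not_dvd_imp_multiplicity_0)
  finally have v: "1 + multiplicity 5 (sigma N) = f 5" .
  \<comment> \<open>Otherwise 5 would have to be 1 mod 5.\<close>
  have "\<not> 5 dvd S 5"
    unfolding S_def using five_dvd_geometric_sum(1)[of "Suc (f 5)" 5] f_even[OF P5]
    by (auto simp del: sum.lessThan_Suc)
  then have "multiplicity 5 (S 5) = 0"
    by (rule not_dvd_imp_multiplicity_0)
  moreover have "multiplicity 5 (sigma N) = (\<Sum>p\<in>P. multiplicity 5 (S p))"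
    unfolding sig using fin S0
    by (intro prime_elem_multiplicity_prod_distrib) (auto, metis less_irrefl)
  ultimately have vsum: "1 + (\<Sum>p\<in>P - {5}. multiplicity 5 (S p)) = f 5"
    using v fin P5 by (simp add: sum.remove)
  \<comment> \<open>The sum \<open>S p\<close> has \<open>f p + 1\<close> terms, an odd number that
    is at least 3.\<close>
  have le: "2 * multiplicity 5 (S p) + 2 \<le> f p" if "p \<in> P" for p
    using multiplicity_5_geometric_sum_le[of "Suc (f p)" p] f_even[OF that] f_ge[OF that]
    unfolding S_def by simp
  have "2 * (\<Sum>p\<in>P - {5}. multiplicity 5 (S p)) + 2 * card (P - {5})
      = (\<Sum>p\<in>P - {5}. 2 * multiplicity 5 (S p) + 2)"
    by (subst sum.distrib) (simp add: sum_distrib_left)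
  also have "\<dots> \<le> (\<Sum>p\<in>P - {5}. f p)"
    using le by (intro sum_mono) auto
  finally have "2 * (\<Sum>p\<in>P - {5}. multiplicity 5 (S p)) + 2 * card (P - {5}) \<le> (\<Sum>p\<in>P - {5}. f p)" .
  moreover have "big_omega N = f 5 + (\<Sum>p\<in>P - {5}. f p)"
  proof -
    have "big_omega N = (\<Sum>p\<in>P. f p)"
      unfolding big_omega_def size_multiset_overloaded_eq P_def f_def
      by (intro sum.cong) (auto simp: count_prime_factorization_prime in_prime_factors_imp_prime)
    then show ?thesis using fin P5 by (simp add: sum.remove)
  qed
  moreover have "small_omega N = Suc (card (P - {5}))"
    unfolding small_omega_def P_def[symmetric] by (rule card.remove[OF fin P5])
  \<comment> \<open>With c = \<open>card (P - {5})\<close>, \<open>big_omega N\<close> is at least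
    \<open>f 5 + 2 * (f 5 - 1)\<close> + 2c, and 2c = \<open>2 * small_omega N - 2\<close>. Finally
    \<open>3 * f 5 \<ge> 6 * a\<close>.\<close>
  ultimately show ?thesis using b vsum by linarith
qed

end
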